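(* For each integer $k\ge 2$, let $R^{\mathrm{asym}}(k)$ (respectively $R^{\mathrm{abs}}(k)$) be the infimum, over all online algorithms for bin packing with cardinality constraint $k$, of the asymptotic (respectively absolute) competitive ratio. Then $\sup_{k\ge 2}R^{\mathrm{asym}}(k)=\sup_{k\ge2}R^{\mathrm{abs}}(k)=2$; that is, the overall asymptotic and absolute competitive ratios for online bin packing with cardinality constraints are both equal to $2$.
   Context: Bin packing with cardinality constraints (CCBP) with integer parameter $k\ge 2$: items with sizes in $(0,1]$ must be partitioned into bins so that each bin has total size at most $1$ and contains at most $k$ items. In the online version items arrive one by one and each must be irrevocably packed (into a new bin or a non-empty bin, respecting both constraints) before the next item arrives. For an input $L$, $A(L)$ denotes the number of bins used by algorithm $A$ and $OPT(L)$ the minimum possible number of bins. The absolute competitive ratio of $A$ is $\sup_L A(L)/OPT(L)$; the asymptotic competitive ratio is $\lim_{K\to\infty}\sup\{A(L)/OPT(L): OPT(L)\ge K\}$. *)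

theory Defs
  imports Complex_Main "HOL-Library.Extended_Real"
begin

definition valid_input :: "real list \<Rightarrow> bool" where
  "valid_input L \<longleftrightarrow> (\<forall>x\<in>set L. 0 < x \<and> x \<le> 1)"

text \<open>
  A packing of \<open>L\<close> assigns to each item index \<open>i < length L\<close> the label \<open>p i\<close> of the bin containing
  it. Labels are arbitrary naturals; a bin exists once some item carries its label, so
  ``opening a new bin'' means choosing a label not used before.
\<close>

definition bin_items :: "real list \<Rightarrow> (nat \<Rightarrow> nat) \<Rightarrow> nat \<Rightarrow> nat set" where
  "bin_items L p b = {i. i < length L \<and> p i = b}"

definition feasible_packing :: "nat \<Rightarrow> real list \<Rightarrow> (nat \<Rightarrow> nat) \<Rightarrow> bool" where
  "feasible_packing k L p \<longleftrightarrow>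
     (\<forall>b. (\<Sum>i\<in>bin_items L p b. L ! i) \<le> 1 \<and> card (bin_items L p b) \<le> k)"

definition bins_used :: "real list \<Rightarrow> (nat \<Rightarrow> nat) \<Rightarrow> nat" where
  "bins_used L p = card (p ` {..<length L})"

definition opt_bins :: "nat \<Rightarrow> real list \<Rightarrow> nat" where
  "opt_bins k L = (LEAST m. \<exists>p. feasible_packing k L p \<and> bins_used L p = m)"

text \<open>
  A deterministic online algorithm maps the sequence of items presented so far (the current item
  being the last one) to the label of the bin receiving the current item. Earlier decisions are
  determined by the shorter prefixes and are therefore irrevocable.
\<close>

type_synonym online_alg = "real list \<Rightarrow> nat"

definition alg_packing :: "online_alg \<Rightarrow> real list \<Rightarrow> nat \<Rightarrow> nat" where
  "alg_packing A L i = A (take (Suc i) L)"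

definition alg_bins :: "online_alg \<Rightarrow> real list \<Rightarrow> nat" where
  "alg_bins A L = bins_used L (alg_packing A L)"

definition ccbp_algorithm :: "nat \<Rightarrow> online_alg \<Rightarrow> bool" where
  "ccbp_algorithm k A \<longleftrightarrow> (\<forall>L. valid_input L \<longrightarrow> feasible_packing k L (alg_packing A L))"

definition perf_ratio :: "nat \<Rightarrow> online_alg \<Rightarrow> real list \<Rightarrow> ereal" where
  "perf_ratio k A L = ereal (real (alg_bins A L) / real (opt_bins k L))"

definition abs_ratio :: "nat \<Rightarrow> online_alg \<Rightarrow> ereal" where
  "abs_ratio k A = (SUP L\<in>{L. valid_input L \<and> L \<noteq> []}. perf_ratio k A L)"

definition asym_ratio :: "nat \<Rightarrow> online_alg \<Rightarrow> ereal" where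
  "asym_ratio k A =
     lim (\<lambda>K::nat. SUP L\<in>{L. valid_input L \<and> K \<le> opt_bins k L}. perf_ratio k A L)"

definition R_abs :: "nat \<Rightarrow> ereal" where
  "R_abs k = (INF A\<in>{A. ccbp_algorithm k A}. abs_ratio k A)"

definition R_asym :: "nat \<Rightarrow> ereal" where
  "R_asym k = (INF A\<in>{A. ccbp_algorithm k A}. asym_ratio k A)"

text \<open>The limit in \<open>asym_ratio\<close> always exists, so \<open>lim\<close> denotes a genuine limit.\<close>

lemma asym_ratio_LIMSEQ:
  "(\<lambda>K::nat. SUP L\<in>{L. valid_input L \<and> K \<le> opt_bins k L}. perf_ratio k A L)
     \<longlonglongrightarrow> asym_ratio k A"
proof -
  have "decseq (\<lambda>K::nat. SUP L\<in>{L. valid_input L \<and> K \<le> opt_bins k L}. perf_ratio k A L)"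
    by (intro decseq_SucI SUP_subset_mono) auto
  from LIMSEQ_INF[OF this] show ?thesis
    unfolding asym_ratio_def by (simp add: limI)
qed

end

theory Submission
  imports Defs
begin

text \<open>
  Upper bound. \<open>OPT\<close> is at least the total size and at least the number of items divided by \<open>k\<close>.
  Apart from one bin \<open>Q\<close>, the algorithm keeps its bins split into a set \<open>G\<close> which is on average half
  full both by size and by number of items, and a set \<open>M\<close> of open bins that either all have load
  at least \<open>1/2\<close> or all contain exactly \<open>k - 1\<close> items; hence one of the two bounds always gives
  factor 2. Whenever an item \<open>x\<close> fits into no bin of one kind, such a bin \<open>a\<close> and the bin \<open>b\<close>
  receiving \<open>x\<close> have total load above 1, so if together they hold at least \<open>k\<close> items, the pair can
  be moved to \<open>G\<close>.

  Lower bound. The adversary presents \<open>k * n\<close> tiny items, chosen adaptively so that every item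
  opening a bin is at least \<open>k\<close> times as large as every item that does not. If fewer than \<open>2 * n\<close>
  bins are open, \<open>n\<close> huge items follow, each of which fits together with \<open>k - 1\<close> of the
  smaller items but with none of the larger ones. Every huge item needs a new bin, at least
  \<open>2 * n\<close> bins in total, whereas \<open>OPT\<close> uses \<open>n\<close> bins for the huge and the smaller items and
  only \<open>2 * n / k\<close> further bins for the larger ones.
\<close>

section \<open>Bounds on the optimum\<close>

lemma feasible_packing_exists:
  assumes "valid_input L" "1 \<le> k"
  shows "\<exists>p. feasible_packing k L p"
proof
  have "bin_items L (\<lambda>i. i) b = (if b < length L then {b} else {})" for b
    by (auto simp: bin_items_def)
  then show "feasible_packing k L (\<lambda>i. i)"
    using assms by (auto simp: feasible_packing_def valid_input_def)
qed

lemma opt_bins_attained: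
  assumes "valid_input L" "1 \<le> k"
  obtains p where "feasible_packing k L p" "bins_used L p = opt_bins k L"
proof -
  have "\<exists>m p. feasible_packing k L p \<and> bins_used L p = m"
    using feasible_packing_exists[OF assms] by blast
  from LeastI_ex[OF this] show ?thesis
    using that unfolding opt_bins_def by blast
qed

lemma opt_bins_le:
  assumes "feasible_packing k L p"
  shows "opt_bins k L \<le> bins_used L p"
  unfolding opt_bins_def using assms by (blast intro: Least_le)

text \<open>Double counting over the bins. The values are kept general because both item sizes and
  the constant 1 are summed.\<close>

lemma sum_bin_items:
  fixes h :: "nat \<Rightarrow> 'a::comm_monoid_add"
  shows "(\<Sum>b\<in>p ` {..<length L}. \<Sum>i\<in>bin_items L p b. h i) = (\<Sum>i<length L. h i)"
  using sum.group[of "{..<length L}" "p ` {..<length L}" p h]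
  by (simp add: bin_items_def)

lemma sum_card_bin_items:
  "(\<Sum>b\<in>p ` {..<length L}. card (bin_items L p b)) = length L"
  using sum_bin_items[where h = "\<lambda>_. 1::nat" and p = p and L = L] by simp

lemma opt_bins_ge_size:
  assumes "valid_input L" "1 \<le> k"
  shows "(\<Sum>i<length L. L ! i) \<le> real (opt_bins k L)"
proof -
  obtain p where p: "feasible_packing k L p" "bins_used L p = opt_bins k L"
    using opt_bins_attained[OF assms] .
  have "(\<Sum>i<length L. L ! i) \<le> (\<Sum>b\<in>p ` {..<length L}. 1)"
    unfolding sum_bin_items[where p = p, symmetric]
    using p(1) by (intro sum_mono) (auto simp: feasible_packing_def)
  then show ?thesis using p(2) by (simp add: bins_used_def)
qed

lemma opt_bins_ge_length:
  assumes "valid_input L" "1 \<le> k"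
  shows "length L \<le> k * opt_bins k L"
proof -
  obtain p where p: "feasible_packing k L p" "bins_used L p = opt_bins k L"
    using opt_bins_attained[OF assms] .
  have "(\<Sum>b\<in>p ` {..<length L}. card (bin_items L p b)) \<le> (\<Sum>b\<in>p ` {..<length L}. k)"
    using p(1) by (intro sum_mono) (auto simp: feasible_packing_def)
  then have "length L \<le> (\<Sum>b\<in>p ` {..<length L}. k)" by (simp only: sum_card_bin_items)
  then show ?thesis using p(2) by (simp add: bins_used_def mult.commute)
qed

lemma finite_bin_items [simp]: "finite (bin_items L p b)"
  by (simp add: bin_items_def)

lemma valid_input_append [simp]:
  "valid_input (xs @ ys) \<longleftrightarrow> valid_input xs \<and> valid_input ys"
  by (auto simp: valid_input_def)

section \<open>A 2-competitive algorithm\<close>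

text \<open>Reduces the design of an algorithm to showing that some bin always preserves an
  invariant. Choosing such a bin by \<open>SOME\<close> makes each decision a function of the items
  seen so far. The last hypothesis is needed because the resulting packing is only determined on the
  indices of \<open>L\<close>.\<close>

lemma online_alg_of_invariant:
  fixes Inv :: "real list \<Rightarrow> (nat \<Rightarrow> nat) \<Rightarrow> bool"
  assumes base: "\<And>p. Inv [] p"
    and step: "\<And>L p x. \<lbrakk>valid_input L; 0 < x; x \<le> 1; Inv L p\<rbrakk>
                 \<Longrightarrow> \<exists>b. Inv (L @ [x]) (p(length L := b))"
    and cong: "\<And>L p q. \<lbrakk>Inv L p; \<And>i. i < length L \<Longrightarrow> p i = q i\<rbrakk> \<Longrightarrow> Inv L q"
  obtains A where "\<And>L. valid_input L \<Longrightarrow> Inv L (alg_packing A L)"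
proof -
  define nxt where "nxt L p x = (SOME b. Inv (L @ [x]) (p(length L := b)))" for L p x
  \<comment> \<open>An algorithm is given only the items, so its own earlier decisions are
    recomputed by replaying the prefix.\<close>
  define st where "st = foldl (\<lambda>(L, p) x. (L @ [x], p(length L := nxt L p x))) ([], \<lambda>_. 0)"
  define P where "P L = snd (st L)" for L
  have st_Nil: "st [] = ([], \<lambda>_. 0)" by (simp add: st_def)
  have st_snoc: "st (L @ [x]) = (fst (st L) @ [x],
      (snd (st L))(length (fst (st L)) := nxt (fst (st L)) (snd (st L)) x))" for L x
    by (simp add: st_def case_prod_beta)
  have fst_st: "fst (st L) = L" for L
    by (induction L rule: rev_induct) (simp_all add: st_Nil st_snoc)
  have P_snoc: "P (L @ [x]) = (P L)(length L := nxt L (P L) x)" for L x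
    by (simp add: P_def st_snoc fst_st)
  have Inv_P: "valid_input L \<Longrightarrow> Inv L (P L)" for L
  proof (induction L rule: rev_induct)
    case Nil
    show ?case by (rule base)
  next
    case (snoc x L)
    then have "\<exists>b. Inv (L @ [x]) ((P L)(length L := b))"
      by (intro step) (auto simp: valid_input_def)
    then show ?case
      unfolding P_snoc nxt_def by (rule someI_ex)
  qed
  define A where "A L = P L (length L - 1)" for L
  \<comment> \<open>Later items update later indices only, so the label fixed when item
    \<open>i\<close> arrived persists.\<close>
  have P_take: "i < length L \<Longrightarrow> P (take (Suc i) L) i = P L i" for i L
  proof (induction L rule: rev_induct)
    case (snoc x L)
    show ?case
    proof (cases "i < length L")
      case True
      then show ?thesis using snoc by (simp add: P_snoc)
    next
      case False
      then show ?thesis using snoc.prems by simp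
    qed
  qed simp
  show ?thesis
  proof (rule that)
    fix L assume "valid_input L"
    then show "Inv L (alg_packing A L)"
      by (intro cong[OF Inv_P]) (auto simp: alg_packing_def A_def P_take min_absorb2 Suc_leI)
  qed
qed

text \<open>In the following, \<open>s\<close> gives the load of each bin and \<open>c\<close> the number of its items.\<close>

definition balanced :: "nat \<Rightarrow> (nat \<Rightarrow> real) \<Rightarrow> (nat \<Rightarrow> nat) \<Rightarrow> nat set \<Rightarrow> bool" where
  "balanced k s c G \<longleftrightarrow>
     finite G \<and> real (card G) \<le> 2 * (\<Sum>b\<in>G. s b) \<and> k * card G \<le> 2 * (\<Sum>b\<in>G. c b)"

definition bin_inv ::
  "nat \<Rightarrow> (nat \<Rightarrow> real) \<Rightarrow> (nat \<Rightarrow> nat) \<Rightarrow> nat set \<Rightarrow> nat set \<Rightarrow> nat set \<Rightarrow> bool" where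
  "bin_inv k s c G M Q \<longleftrightarrow>
     balanced k s c G \<and> finite M \<and> (\<exists>q. Q \<subseteq> {q}) \<and>
     G \<inter> M = {} \<and> G \<inter> Q = {} \<and> M \<inter> Q = {} \<and>
     (\<forall>b\<in>G \<union> M \<union> Q. 0 < s b \<and> 0 < c b) \<and>
     (\<forall>b. b \<notin> G \<union> M \<union> Q \<longrightarrow> s b = 0 \<and> c b = 0) \<and>
     (\<forall>b. s b \<le> 1 \<and> c b \<le> k) \<and> (\<forall>b\<in>M \<union> Q. c b < k)"

text \<open>One alternative must hold for all of \<open>M\<close>: the first lets \<open>M\<close>
  be charged to total size, the second to the number of items, as \<open>k - 1\<close> is at least
  \<open>k / 2\<close> for \<open>k\<close> at least 2.\<close>

definition uniform :: "nat \<Rightarrow> (nat \<Rightarrow> real) \<Rightarrow> (nat \<Rightarrow> nat) \<Rightarrow> nat set \<Rightarrow> bool" where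
  "uniform k s c M \<longleftrightarrow> (\<forall>b\<in>M. 1/2 \<le> s b) \<or> (\<forall>b\<in>M. c b = k - 1)"

lemma balanced_cong:
  assumes "balanced k s c G" "\<And>b. b \<in> G \<Longrightarrow> s' b = s b" "\<And>b. b \<in> G \<Longrightarrow> c' b = c b"
  shows "balanced k s' c' G"
  using assms by (simp add: balanced_def)

lemma balanced_Un:
  assumes "balanced k s c G" "balanced k s c H" "G \<inter> H = {}"
  shows "balanced k s c (G \<union> H)"
  using assms by (auto simp: balanced_def card_Un_disjoint sum.union_disjoint algebra_simps)

lemma balanced_insert:
  assumes "balanced k s c G" "b \<notin> G" "s' = s(b := y)" "c' = c(b := d)" "1/2 \<le> y" "k \<le> d"
  shows "balanced k s' c' (insert b G)"
proof -
  have "balanced k s' c' G" using assms by (intro balanced_cong[OF assms(1)]) auto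
  moreover have "balanced k s' c' {b}" using assms by (auto simp: balanced_def)
  ultimately show ?thesis using balanced_Un[of k s' c' G "{b}"] assms(2) by simp
qed

lemma balanced_insert_pair:
  assumes "balanced k s c G" "a \<notin> G" "b \<notin> G" "a \<noteq> b"
    "s' = s(b := y)" "c' = c(b := d)" "1 \<le> s a + y" "k \<le> c a + d"
  shows "balanced k s' c' (insert a (insert b G))"
proof -
  have "balanced k s' c' G" using assms by (intro balanced_cong[OF assms(1)]) auto
  moreover have "balanced k s' c' {a, b}" using assms by (auto simp: balanced_def)
  ultimately show ?thesis using balanced_Un[of k s' c' G "{a, b}"] assms(2,3) by simp
qed

text \<open>Only the values at \<open>b\<close> change, so most of the invariant carries over. Each
  case below then only has to name the new partition and check balance, uniformity and the count of
  \<open>b\<close>.\<close>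

lemma bin_inv_update:
  assumes inv: "bin_inv k s c G M Q" and b: "s b + x \<le> 1" "c b < k" "0 < x"
    and bal: "balanced k (s(b := s b + x)) (c(b := Suc (c b))) G'"
    and part: "G' \<union> M' \<union> Q' = insert b (G \<union> M \<union> Q)" "M' \<union> Q' \<subseteq> insert b (M \<union> Q)"
      "G' \<inter> M' = {}" "G' \<inter> Q' = {}" "M' \<inter> Q' = {}" "Q' \<subseteq> {q}"
    and room: "b \<in> M' \<union> Q' \<Longrightarrow> Suc (c b) < k"
    and unif: "uniform k (s(b := s b + x)) (c(b := Suc (c b))) M'"
  shows "\<exists>b G' M' Q'. bin_inv k (s(b := s b + x)) (c(b := Suc (c b))) G' M' Q' \<and>
           uniform k (s(b := s b + x)) (c(b := Suc (c b))) M'"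
proof -
  let ?s = "s(b := s b + x)" and ?c = "c(b := Suc (c b))"
  have pos: "0 < s d" "0 < c d" if "d \<in> G \<union> M \<union> Q" for d
    using inv that unfolding bin_inv_def by blast+
  have zero: "s d = 0" "c d = 0" if "d \<notin> G \<union> M \<union> Q" for d
    using inv that unfolding bin_inv_def by blast+
  have le: "s d \<le> 1" "c d \<le> k" for d
    using inv unfolding bin_inv_def by blast+
  have lt: "c d < k" if "d \<in> M \<union> Q" for d
    using inv that unfolding bin_inv_def by blast
  have "finite (G \<union> M \<union> Q)"
    using inv finite_subset[of Q "{_}"] unfolding bin_inv_def balanced_def by auto
  then have "finite M'" by (rule rev_finite_subset[OF finite.insertI]) (use part(1) in blast)
  moreover have "0 < ?s d \<and> 0 < ?c d" if "d \<in> G' \<union> M' \<union> Q'" for d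
  proof (cases "d = b")
    case True
    have "0 \<le> s b" using pos(1)[of b] zero(1)[of b] by fastforce
    then show ?thesis using True b by simp
  next
    case False
    then show ?thesis using that part(1) pos[of d] by simp
  qed
  moreover have "?s d = 0 \<and> ?c d = 0" if "d \<notin> G' \<union> M' \<union> Q'" for d
    using that part(1) zero[of d] by auto
  moreover have "?s d \<le> 1 \<and> ?c d \<le> k" for d
    using le[of d] b by simp
  moreover have "?c d < k" if "d \<in> M' \<union> Q'" for d
    using that room part(2) lt[of d] by (cases "d = b") auto
  ultimately have "bin_inv k ?s ?c G' M' Q'"
    unfolding bin_inv_def using bal part(3-6) by blast
  then show ?thesis using unif by blast
qed

lemma bin_inv_cases:
  assumes "bin_inv k s c G M Q"
  obtains "Q = {}" | q where "Q = {q}" "q \<notin> G" "q \<notin> M" "0 < s q" "0 < c q" "c q < k"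
proof -
  obtain q where "Q \<subseteq> {q}" using assms unfolding bin_inv_def by blast
  then have "Q = {} \<or> Q = {q}" by blast
  then show ?thesis
  proof
    assume Q: "Q = {q}"
    then have "q \<notin> G" "q \<notin> M" "0 < s q" "0 < c q" "c q < k"
      using assms by (simp_all add: bin_inv_def)
    then show ?thesis using Q that(2) by blast
  qed (rule that(1))
qed

text \<open>Prepares the hypotheses of the two step lemmas. The obstacle is a bin in
  \<open>Q\<close> with \<open>k - 1\<close> items while \<open>M\<close> is not a nonempty set of
  half-full bins; then all of \<open>M\<close> has \<open>k - 1\<close> items, and the bin of
  \<open>Q\<close> can join it.\<close>

lemma bin_inv_normalize:
  assumes inv: "bin_inv k s c G M Q" and unif: "uniform k s c M"
  obtains M' Q' where "bin_inv k s c G M' Q'"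
    "(\<forall>b\<in>M'. 1/2 \<le> s b) \<and> (M' = {} \<longrightarrow> (\<forall>b\<in>Q'. c b < k - 1)) \<or>
     M' \<noteq> {} \<and> (\<forall>b\<in>M'. c b = k - 1) \<and> (\<forall>b\<in>Q'. c b < k - 1)"
proof (cases "(\<forall>b\<in>M. 1/2 \<le> s b) \<and> M \<noteq> {} \<or> (\<forall>b\<in>Q. c b < k - 1)")
  case True
  show ?thesis
    by (rule that[OF inv]) (use True unif in \<open>unfold uniform_def, blast\<close>)
next
  case False
  then have M: "\<forall>b\<in>M. c b = k - 1" using unif unfolding uniform_def by blast
  obtain q where q: "Q = {q}" "q \<notin> M" "c q < k"
    using bin_inv_cases[OF inv] False by blast
  then have cq: "c q = k - 1" using False by auto
  have "bin_inv k s c G (insert q M) {}"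
    using inv q unfolding bin_inv_def by simp
  then show ?thesis by (rule that) (use M cq in simp)
qed

text \<open>
  An item is put into \<open>Q\<close> only if it fits into no bin of \<open>M\<close>. So when \<open>Q\<close> receives its \<open>k\<close>-th item,
  it can be paired with any bin of \<open>M\<close>. If a new bin has to be opened, then it or \<open>Q\<close> has load
  at least \<open>1/2\<close> and can join \<open>M\<close>.
\<close>

lemma bin_inv_step_loaded:
  assumes inv: "bin_inv k s c G M Q" and k: "2 \<le> k" and x: "0 < x" "x \<le> 1"
    and M: "\<forall>b\<in>M. 1/2 \<le> s b" "M = {} \<longrightarrow> (\<forall>b\<in>Q. c b < k - 1)"
  shows "\<exists>b G' M' Q'. bin_inv k (s(b := s b + x)) (c(b := Suc (c b))) G' M' Q' \<and>
           uniform k (s(b := s b + x)) (c(b := Suc (c b))) M'"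
proof -
  let ?s = "\<lambda>b. s(b := s b + x)" and ?c = "\<lambda>b. c(b := Suc (c b))"
  have disj: "G \<inter> M = {}" "G \<inter> Q = {}" "M \<inter> Q = {}" and bal: "balanced k s c G"
    using inv unfolding bin_inv_def by blast+
  obtain q0 where q0: "Q \<subseteq> {q0}" using inv unfolding bin_inv_def by blast
  have bal': "balanced k (?s b) (?c b) G" if "b \<notin> G" for b
    using that by (intro balanced_cong[OF bal]) auto
  have unif: "uniform k (?s b) (?c b) M'" if "M' \<subseteq> insert b M" "b \<in> M' \<Longrightarrow> 1/2 \<le> s b + x" for b M'
    using that M(1) unfolding uniform_def by auto
  show ?thesis
  proof (cases "\<exists>b\<in>M. s b + x \<le> 1")
    case True
    then obtain b where b: "b \<in> M" "s b + x \<le> 1" by blast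
    have bG: "b \<notin> G" using disj b by blast
    have cb: "c b < k" using inv b unfolding bin_inv_def by blast
    have sb: "1/2 \<le> s b + x" using M b x by force
    show ?thesis
    proof (cases "Suc (c b) = k")
      case True
      \<comment> \<open>With \<open>k\<close> items and load at least 1/2, \<open>b\<close> is
        balanced on its own.\<close>
      have "balanced k (?s b) (?c b) (insert b G)"
        using True sb by (intro balanced_insert[OF bal bG]) auto
      then show ?thesis
        by (rule bin_inv_update[OF inv b(2) cb x(1), where M' = "M - {b}" and Q' = Q, OF _ _ _ _ _ _ q0])
          (use b disj in \<open>auto intro: unif\<close>)
    next
      case False
      show ?thesis
        by (rule bin_inv_update[OF inv b(2) cb x(1) bal'[OF bG], where M' = M, OF _ _ _ _ _ q0])
          (use b cb sb disj False in \<open>auto intro: unif\<close>)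
    qed
  next
    case noM: False
    show ?thesis
    proof (cases "\<exists>q\<in>Q. s q + x \<le> 1")
      case True
      then obtain q where q: "Q = {q}" "s q + x \<le> 1" "q \<notin> G" "q \<notin> M" "0 < s q" "c q < k"
        using bin_inv_cases[OF inv] by (metis empty_iff singletonD)
      show ?thesis
      proof (cases "Suc (c q) = k")
        case True
        \<comment> \<open>Before \<open>x\<close>, the bin \<open>q\<close> held
          \<open>k - 1\<close> items, which the hypothesis on \<open>Q\<close> excludes when
          \<open>M\<close> is empty.\<close>
        then have "M \<noteq> {}" using M q by auto
        then obtain a where a: "a \<in> M" "1 < s a + x" using noM by force
        have aG: "a \<notin> G" "a \<noteq> q" using disj a q by auto
        have "balanced k (?s q) (?c q) (insert a (insert q G))"
          using True aG q a by (intro balanced_insert_pair[OF bal]) auto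
        then show ?thesis
          by (rule bin_inv_update[OF inv q(2,6) x(1), where M' = "M - {a}" and Q' = "{}" and q = q])
            (use a aG q disj in \<open>auto intro: unif\<close>)
      next
        case False
        show ?thesis
          by (rule bin_inv_update[OF inv q(2,6) x(1) bal'[OF q(3)], where M' = M, OF _ _ _ _ _ q0])
            (use q disj False in \<open>auto intro: unif\<close>)
      qed
    next
      case noQ: False
      have "finite (G \<union> M \<union> Q)"
        using inv q0 finite_subset[of Q "{q0}"] unfolding bin_inv_def balanced_def by auto
      then obtain b where b: "b \<notin> G \<union> M \<union> Q" using ex_new_if_finite[OF infinite_UNIV_nat] by metis
      have b0: "s b = 0" "c b = 0" using inv b unfolding bin_inv_def by blast+
      have bG: "b \<notin> G" using b by blast
      show ?thesis
      proof (cases "1/2 \<le> x")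
        case True
        then have "uniform k (?s b) (?c b) (insert b M)" using b0 by (intro unif) auto
        then show ?thesis
          by (intro bin_inv_update[OF inv _ _ x(1) bal'[OF bG], where M' = "insert b M", OF _ _ _ _ _ _ _ q0])
            (use b b0 k x disj in auto)
      next
        case False
        \<comment> \<open>A small \<open>x\<close> overflows \<open>Q\<close> only if
          \<open>Q\<close> is more than half full; \<open>Q\<close> then joins \<open>M\<close> and
          the new bin takes its place.\<close>
        then have "\<forall>q\<in>Q. 1/2 \<le> s q" using noQ by auto
        then have "uniform k (?s b) (?c b) (M \<union> Q)"
          using M(1) b unfolding uniform_def by auto
        then show ?thesis
          by (intro bin_inv_update[OF inv _ _ x(1) bal'[OF bG], where M' = "M \<union> Q" and Q' = "{b}" and q = b])
            (use b b0 k x disj in auto)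
      qed
    qed
  qed
qed

text \<open>
  Here an item that does not fit into \<open>Q\<close> completes some \<open>b \<in> M\<close>, which is then paired with \<open>Q\<close>,
  or, if it does not fit into \<open>b\<close> either, opens a new bin, which is paired with \<open>b\<close>.
\<close>

lemma bin_inv_step_crowded:
  assumes inv: "bin_inv k s c G M Q" and k: "2 \<le> k" and x: "0 < x" "x \<le> 1"
    and M: "M \<noteq> {}" "\<forall>b\<in>M. c b = k - 1" "\<forall>b\<in>Q. c b < k - 1"
  shows "\<exists>b G' M' Q'. bin_inv k (s(b := s b + x)) (c(b := Suc (c b))) G' M' Q' \<and>
           uniform k (s(b := s b + x)) (c(b := Suc (c b))) M'"
proof -
  let ?s = "\<lambda>b. s(b := s b + x)" and ?c = "\<lambda>b. c(b := Suc (c b))"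
  have disj: "G \<inter> M = {}" "G \<inter> Q = {}" "M \<inter> Q = {}" and bal: "balanced k s c G"
    using inv unfolding bin_inv_def by blast+
  obtain q0 where q0: "Q \<subseteq> {q0}" using inv unfolding bin_inv_def by blast
  have bal': "balanced k (?s b) (?c b) G" if "b \<notin> G" for b
    using that by (intro balanced_cong[OF bal]) auto
  have unif: "uniform k (?s b) (?c b) M'" if "M' \<subseteq> M" "b \<notin> M'" for b M'
    using that M(2) unfolding uniform_def by auto
  have "finite (G \<union> M \<union> Q)"
    using inv q0 finite_subset[of Q "{q0}"] unfolding bin_inv_def balanced_def by auto
  then obtain f where f: "f \<notin> G \<union> M \<union> Q" using ex_new_if_finite[OF infinite_UNIV_nat] by metis
  have f0: "s f = 0" "c f = 0" using inv f unfolding bin_inv_def by blast+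
  have fG: "f \<notin> G" using f by blast
  from inv show ?thesis
  proof (cases rule: bin_inv_cases)
    \<comment> \<open>With \<open>Q\<close> empty, \<open>x\<close> opens a new bin that becomes
      \<open>Q\<close>, even if it would fit into \<open>M\<close>.\<close>
    case 1
    have "uniform k (?s f) (?c f) M" using f by (intro unif) auto
    then show ?thesis
      by (intro bin_inv_update[OF inv _ _ x(1) bal'[OF fG], where M' = M and Q' = "{f}" and q = f])
        (use 1 f f0 k x disj in auto)
  next
    case (2 q)
    then have cq: "c q < k - 1" using M by blast
    show ?thesis
    proof (cases "s q + x \<le> 1")
      case True
      show ?thesis
        by (rule bin_inv_update[OF inv True _ x(1) bal'[OF 2(2)], where M' = M, OF _ _ _ _ _ _ q0])
          (use 2 cq disj in \<open>auto intro: unif\<close>)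
    next
      case False
      obtain b where b: "b \<in> M" using M by blast
      have bG: "b \<notin> G" "b \<noteq> q" "c b = k - 1" "0 < s b"
        using b disj 2 M(2) inv by (auto simp: bin_inv_def)
      show ?thesis
      proof (cases "s b + x \<le> 1")
        case True
        \<comment> \<open>The load of \<open>q\<close> plus \<open>x\<close> already exceeds 1, and
          \<open>b\<close> alone now has \<open>k\<close> items.\<close>
        have "balanced k (?s b) (?c b) (insert q (insert b G))"
          using 2 bG False by (intro balanced_insert_pair[OF bal]) auto
        moreover have "uniform k (?s b) (?c b) (M - {b})" by (intro unif) auto
        ultimately show ?thesis
          by (intro bin_inv_update[OF inv True _ x(1), where M' = "M - {b}" and Q' = "{}" and q = q])
            (use 2 b bG k disj in auto)
      next
        case noB: False
        \<comment> \<open>The count is tight: \<open>k - 1\<close> items in \<open>b\<close> and the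
          single item \<open>x\<close> in \<open>f\<close>.\<close>
        have "balanced k (?s f) (?c f) (insert b (insert f G))"
          using bG f f0 b noB by (intro balanced_insert_pair[OF bal]) auto
        moreover have "uniform k (?s f) (?c f) (M - {b})" using f by (intro unif) auto
        ultimately show ?thesis
          by (intro bin_inv_update[where b = f and G' = "insert b (insert f G)" and M' = "M - {b}"
                and Q' = Q and q = q, OF inv _ _ x(1)])
            (use 2 b bG f f0 k x disj in auto)
      qed
    qed
  qed
qed

lemma bin_inv_step:
  assumes "bin_inv k s c G M Q" "uniform k s c M" "2 \<le> k" "0 < x" "x \<le> 1"
  shows "\<exists>b G' M' Q'. bin_inv k (s(b := s b + x)) (c(b := Suc (c b))) G' M' Q' \<and>
           uniform k (s(b := s b + x)) (c(b := Suc (c b))) M'"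
  using assms(1,2)
proof (rule bin_inv_normalize)
  fix M' Q'
  assume "bin_inv k s c G M' Q'"
    "(\<forall>b\<in>M'. 1/2 \<le> s b) \<and> (M' = {} \<longrightarrow> (\<forall>b\<in>Q'. c b < k - 1)) \<or>
     M' \<noteq> {} \<and> (\<forall>b\<in>M'. c b = k - 1) \<and> (\<forall>b\<in>Q'. c b < k - 1)"
  then show ?thesis
    using bin_inv_step_loaded[OF _ assms(3-5)] bin_inv_step_crowded[OF _ assms(3-5)] by blast
qed

section \<open>From abstract loads and counts back to packings\<close>

definition load :: "real list \<Rightarrow> (nat \<Rightarrow> nat) \<Rightarrow> nat \<Rightarrow> real" where
  "load L p b = (\<Sum>i\<in>bin_items L p b. L ! i)"

definition occupancy :: "real list \<Rightarrow> (nat \<Rightarrow> nat) \<Rightarrow> nat \<Rightarrow> nat" where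
  "occupancy L p b = card (bin_items L p b)"

lemma bin_items_snoc:
  "bin_items (L @ [x]) (p(length L := b)) =
     (bin_items L p)(b := insert (length L) (bin_items L p b))"
  by (auto simp: bin_items_def fun_eq_iff)

lemma occupancy_snoc:
  "occupancy (L @ [x]) (p(length L := b)) = (occupancy L p)(b := Suc (occupancy L p b))"
proof -
  have "length L \<notin> bin_items L p b" by (simp add: bin_items_def)
  then show ?thesis by (simp add: occupancy_def bin_items_snoc fun_eq_iff)
qed

lemma load_snoc:
  "load (L @ [x]) (p(length L := b)) = (load L p)(b := load L p b + x)"
proof -
  have "length L \<notin> bin_items L p b" by (simp add: bin_items_def)
  moreover have "(\<Sum>i\<in>bin_items L p b'. (L @ [x]) ! i) = (\<Sum>i\<in>bin_items L p b'. L ! i)" for b'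
    by (intro sum.cong) (auto simp: bin_items_def nth_append)
  ultimately show ?thesis by (simp add: load_def bin_items_snoc fun_eq_iff)
qed

lemma bin_inv_feasible:
  assumes "bin_inv k (load L p) (occupancy L p) G M Q"
  shows "feasible_packing k L p"
  using assms by (simp add: bin_inv_def feasible_packing_def load_def occupancy_def)

lemma bin_inv_bins_used_le:
  assumes inv: "bin_inv k (load L p) (occupancy L p) G M Q"
    and unif: "uniform k (load L p) (occupancy L p) M"
    and L: "valid_input L" and k: "2 \<le> k"
  shows "bins_used L p \<le> 2 * opt_bins k L"
proof -
  let ?s = "load L p" and ?c = "occupancy L p"
  have fin: "finite G" "finite M" "finite Q"
    using inv by (auto simp: bin_inv_def balanced_def intro: finite_subset)
  have img: "p ` {..<length L} = G \<union> M \<union> Q"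
  proof -
    have "b \<in> p ` {..<length L} \<longleftrightarrow> ?c b \<noteq> 0" for b
      by (auto simp: occupancy_def) (auto simp: bin_items_def)
    moreover have "b \<in> G \<union> M \<union> Q \<longleftrightarrow> ?c b \<noteq> 0" for b
      using inv unfolding bin_inv_def by (metis less_numeral_extra(3))
    ultimately show ?thesis by blast
  qed
  have disj: "G \<inter> M = {}" "(G \<union> M) \<inter> Q = {}" using inv by (auto simp: bin_inv_def)
  have used: "bins_used L p = card G + card M + card Q"
    using disj fin by (simp add: bins_used_def img card_Un_disjoint)
  have S: "sum ?s G + sum ?s M + sum ?s Q = (\<Sum>i<length L. L ! i)"
    using sum_bin_items[where p = p and L = L and h = "\<lambda>i. L ! i"] disj fin
    by (simp add: img sum.union_disjoint load_def)
  have N: "sum ?c G + sum ?c M + sum ?c Q = length L"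
    using sum_card_bin_items[where p = p and L = L] disj fin
    by (simp add: img sum.union_disjoint occupancy_def)
  have G: "real (card G) \<le> 2 * sum ?s G" "k * card G \<le> 2 * sum ?c G"
    using inv by (auto simp: bin_inv_def balanced_def)
  have optS: "(\<Sum>i<length L. L ! i) \<le> opt_bins k L" and optN: "length L \<le> k * opt_bins k L"
    using opt_bins_ge_size[OF L] opt_bins_ge_length[OF L] k by auto
  \<comment> \<open>The extra 1 pays for \<open>Q\<close>. Its bin has positive load and count, so
    the inequality is strict and integrality removes the 1.\<close>
  from unif have "card G + card M + card Q < 2 * opt_bins k L + 1"
    unfolding uniform_def
  proof
    assume "\<forall>b\<in>M. 1/2 \<le> ?s b"
    then have "real (card M) \<le> 2 * sum ?s M"
      using sum_mono[of M "\<lambda>_. 1/2" ?s] by simp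
    then have "real (card G + card M + card Q) < real (2 * opt_bins k L + 1)"
      using G optS S by (cases rule: bin_inv_cases[OF inv]) auto
    then show ?thesis by linarith
  next
    assume "\<forall>b\<in>M. ?c b = k - 1"
    then have "2 * sum ?c M = 2 * (k - 1) * card M" by simp
    moreover have "k * card M \<le> 2 * (k - 1) * card M" using k by (intro mult_right_mono) auto
    ultimately have "k * card M \<le> 2 * sum ?c M" by linarith
    moreover have "k * card Q < 2 * sum ?c Q + k"
      using k by (cases rule: bin_inv_cases[OF inv]) auto
    ultimately have "k * (card G + card M + card Q) < k * (2 * opt_bins k L + 1)"
      using G optN N unfolding distrib_left by linarith
    then show ?thesis by (simp only: mult_less_cancel1)
  qed
  then show ?thesis using used by simp
qed

lemma two_competitive_algorithm_exists:
  assumes k: "2 \<le> k"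
  obtains A where "ccbp_algorithm k A"
    "\<And>L. valid_input L \<Longrightarrow> alg_bins A L \<le> 2 * opt_bins k L"
proof -
  let ?Inv = "\<lambda>L p. \<exists>G M Q. bin_inv k (load L p) (occupancy L p) G M Q \<and>
                uniform k (load L p) (occupancy L p) M"
  obtain A where A: "\<And>L. valid_input L \<Longrightarrow> ?Inv L (alg_packing A L)"
  proof (rule online_alg_of_invariant[of ?Inv])
    fix p
    have "bin_inv k (load [] p) (occupancy [] p) {} {} {} \<and> uniform k (load [] p) (occupancy [] p) {}"
      by (auto simp: bin_inv_def uniform_def balanced_def load_def occupancy_def bin_items_def)
    then show "?Inv [] p" by blast
  next
    fix L p and x :: real
    assume "0 < x" "x \<le> 1" "?Inv L p"
    then show "\<exists>b. ?Inv (L @ [x]) (p(length L := b))"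
      using bin_inv_step k unfolding occupancy_snoc load_snoc by blast
  next
    fix L :: "real list" and p q :: "nat \<Rightarrow> nat"
    assume Inv: "?Inv L p" and eq: "\<And>i. i < length L \<Longrightarrow> p i = q i"
    have "bin_items L p = bin_items L q" using eq by (auto simp: bin_items_def)
    then have "load L p = load L q" "occupancy L p = occupancy L q"
      by (auto simp: load_def occupancy_def)
    then show "?Inv L q" using Inv by simp
  qed blast
  show ?thesis
  proof
    show "ccbp_algorithm k A"
      using A bin_inv_feasible unfolding ccbp_algorithm_def by blast
    show "alg_bins A L \<le> 2 * opt_bins k L" if "valid_input L" for L
      using A[OF that] bin_inv_bins_used_le[OF _ _ that k] unfolding alg_bins_def by blast
  qed
qed

lemma opt_bins_pos:
  assumes "valid_input L" "1 \<le> k" "L \<noteq> []"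
  shows "0 < opt_bins k L"
  using opt_bins_ge_length[OF assms(1,2)] assms(3) by (cases "opt_bins k L") auto

lemma R_abs_le_2:
  assumes "2 \<le> k"
  shows "R_abs k \<le> 2"
proof -
  obtain A where A: "ccbp_algorithm k A"
    "\<And>L. valid_input L \<Longrightarrow> alg_bins A L \<le> 2 * opt_bins k L"
    using two_competitive_algorithm_exists[OF assms] by blast
  have "perf_ratio k A L \<le> 2" if "valid_input L" "L \<noteq> []" for L
  proof -
    have "real (alg_bins A L) \<le> 2 * real (opt_bins k L)" using A(2)[OF that(1)] by linarith
    then have "real (alg_bins A L) / real (opt_bins k L) \<le> 2"
      using opt_bins_pos[OF that(1) _ that(2), of k] assms by (simp add: divide_le_eq)
    then have "perf_ratio k A L \<le> ereal 2" unfolding perf_ratio_def by simp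
    then show ?thesis by simp
  qed
  then have "abs_ratio k A \<le> 2" unfolding abs_ratio_def by (intro SUP_least) auto
  then show ?thesis unfolding R_abs_def using A(1) by (intro INF_lower2) auto
qed

lemma asym_ratio_le_abs_ratio: "asym_ratio k A \<le> abs_ratio k A"
proof (rule LIMSEQ_le_const2[OF asym_ratio_LIMSEQ], intro exI[of _ 1] allI impI)
  fix K :: nat assume "1 \<le> K"
  \<comment> \<open>The absolute ratio ranges over nonempty inputs; from \<open>K = 1\<close> on the
    empty input is excluded on the left as well.\<close>
  have "opt_bins k [] = 0"
    by (simp add: opt_bins_def bins_used_def feasible_packing_def bin_items_def)
  then show "(SUP L\<in>{L. valid_input L \<and> K \<le> opt_bins k L}. perf_ratio k A L) \<le> abs_ratio k A"
    using \<open>1 \<le> K\<close> unfolding abs_ratio_def by (intro SUP_subset_mono) auto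
qed

lemma R_asym_le_R_abs: "R_asym k \<le> R_abs k"
  unfolding R_asym_def R_abs_def by (intro INF_mono) (auto intro: asym_ratio_le_abs_ratio)

section \<open>The adversary\<close>

definition opens_bin :: "online_alg \<Rightarrow> real list \<Rightarrow> nat \<Rightarrow> bool" where
  "opens_bin A L i \<longleftrightarrow> alg_packing A L i \<notin> alg_packing A L ` {..<i}"

lemma alg_packing_append:
  "i < length L \<Longrightarrow> alg_packing A (L @ L') i = alg_packing A L i"
  by (simp add: alg_packing_def)

text \<open>This makes adaptivity possible: a decision already observed is not affected by the items
  chosen afterwards.\<close>

lemma opens_bin_append:
  "i < length L \<Longrightarrow> opens_bin A (L @ L') i = opens_bin A L i"
  by (auto simp: opens_bin_def alg_packing_append image_iff)

text \<open>
  A gap \<open>[lo, hi]\<close> of ratio \<open>R * R\<close> contains the item \<open>R * lo\<close>, which leaves a gap of ratio \<open>R\<close> on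
  whichever side the algorithm's decision requires.
\<close>

lemma adaptive_gap:
  assumes R: "1 \<le> R" and k: "0 < k"
  shows "\<exists>L lo hi. length L = N \<and> 0 < lo \<and> R * lo \<le> hi \<and> hi \<le> 1 / real k \<and>
    (\<forall>i<N. 0 < L ! i \<and> L ! i \<le> 1 / real k \<and> (if opens_bin A L i then hi \<le> L ! i else L ! i \<le> lo))"
  using R
proof (induction N arbitrary: R)
  case 0
  then show ?case
    using k by (intro exI[of _ "[]"] exI[of _ "1 / (R * real k)"] exI[of _ "1 / real k"]) auto
next
  case (Suc N)
  \<comment> \<open>The earlier items must leave a gap of ratio \<open>R * R\<close>, to be split by
    the last one; hence the induction generalises over \<open>R\<close>.\<close>
  have "1 \<le> R * R" using Suc.prems mult_mono[of 1 R 1 R] by simp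
  from Suc.IH[OF this] obtain L lo hi where
    L: "length L = N" "0 < lo" "R * R * lo \<le> hi" "hi \<le> 1 / real k"
    "\<forall>i<N. 0 < L ! i \<and> L ! i \<le> 1 / real k \<and> (if opens_bin A L i then hi \<le> L ! i else L ! i \<le> lo)"
    by blast
  define v where "v = R * lo"
  have v: "lo \<le> v" "v \<le> hi" "R * v \<le> hi" "0 < v"
  proof -
    show "lo \<le> v" using Suc.prems L(2) by (simp add: v_def)
    then show "0 < v" using L(2) by simp
    show "R * v \<le> hi" using L(3) by (simp add: v_def mult.assoc)
    moreover have "v \<le> R * v" using Suc.prems \<open>0 < v\<close> by simp
    ultimately show "v \<le> hi" by simp
  qed
  let ?L = "L @ [v]"
  define lo' hi' where "lo' = (if opens_bin A ?L N then lo else v)"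
    and "hi' = (if opens_bin A ?L N then v else hi)"
  have "length ?L = Suc N \<and> 0 < lo' \<and> R * lo' \<le> hi' \<and> hi' \<le> 1 / real k"
    using L v by (auto simp: lo'_def hi'_def v_def)
  moreover have "0 < ?L ! i \<and> ?L ! i \<le> 1 / real k \<and>
      (if opens_bin A ?L i then hi' \<le> ?L ! i else ?L ! i \<le> lo')" if "i < Suc N" for i
  proof (cases "i = N")
    case True
    then show ?thesis using L v by (auto simp: lo'_def hi'_def)
  next
    case False
    then have "i < N" using that by simp
    moreover have "lo \<le> lo'" "hi' \<le> hi" using v by (auto simp: lo'_def hi'_def)
    ultimately show ?thesis using L(5) L(1)
      by (auto simp: opens_bin_append nth_append split: if_splits)
  qed
  ultimately show ?case by blast
qed

text \<open>Every bin has exactly one first item, the one of least index.\<close>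

lemma card_opens_bin: "card {i. i < length L \<and> opens_bin A L i} = alg_bins A L"
proof -
  let ?p = "alg_packing A L"
  have "inj_on ?p {i. i < length L \<and> opens_bin A L i}"
    by (rule inj_onI) (metis (mono_tags, lifting) imageI lessThan_iff linorder_neqE_nat
        mem_Collect_eq opens_bin_def)
  moreover have "?p ` {i. i < length L \<and> opens_bin A L i} = ?p ` {..<length L}"
  proof (intro equalityI subsetI)
    fix b assume "b \<in> ?p ` {..<length L}"
    then have ex: "\<exists>i. i < length L \<and> ?p i = b" by auto
    define i where "i = (LEAST i. i < length L \<and> ?p i = b)"
    have i: "i < length L" "?p i = b" using LeastI_ex[OF ex] by (auto simp: i_def)
    have "?p j \<noteq> b" if "j < i" for j
      using not_less_Least[of j "\<lambda>i. i < length L \<and> ?p i = b"] that i by (auto simp: i_def)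
    then have "b \<notin> ?p ` {..<i}" by (metis imageE lessThan_iff)
    then have "opens_bin A L i" using i(2) by (simp add: opens_bin_def)
    then show "b \<in> ?p ` {i. i < length L \<and> opens_bin A L i}" using i by blast
  qed auto
  ultimately show ?thesis
    unfolding alg_bins_def bins_used_def by (metis card_image)
qed

lemma opens_bin_exists:
  assumes "i < length L"
  obtains j where "j \<le> i" "opens_bin A L j" "alg_packing A L j = alg_packing A L i"
proof -
  let ?P = "\<lambda>j. alg_packing A L j = alg_packing A L i"
  define j where "j = (LEAST j. ?P j)"
  have "?P j" unfolding j_def by (rule LeastI[of ?P i]) simp
  moreover have "j \<le> i" unfolding j_def by (rule Least_le) simp
  moreover have "\<forall>l<j. \<not> ?P l" using not_less_Least[of _ ?P] unfolding j_def by blast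
  then have "opens_bin A L j" using \<open>?P j\<close> by (auto simp: opens_bin_def)
  ultimately show ?thesis using that by blast
qed

section \<open>Packings that bound the optimum from above\<close>

lemma bounded_fibres:
  assumes "finite X" "card X \<le> q * r" "0 < q"
  obtains f :: "'a \<Rightarrow> nat" where "f ` X \<subseteq> {..<r}" "\<And>b. card {x\<in>X. f x = b} \<le> q"
proof -
  obtain g where g: "bij_betw g X {0..<card X}"
    using ex_bij_betw_finite_nat[OF assms(1)] by blast
  \<comment> \<open>Enumerate \<open>X\<close> and cut the enumeration into consecutive blocks of
    length \<open>q\<close>.\<close>
  define f where "f x = g x div q" for x
  show ?thesis
  proof
    show "f ` X \<subseteq> {..<r}"
    proof
      fix y assume "y \<in> f ` X"
      then obtain x where "x \<in> X" "y = g x div q" by (auto simp: f_def)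
      then have "g x < r * q" using bij_betwE[OF g] assms(2) by (fastforce simp: mult.commute)
      then show "y \<in> {..<r}" using \<open>y = _\<close> assms(3) by (simp add: less_mult_imp_div_less)
    qed
    fix b
    have "inj_on g {x\<in>X. f x = b}"
      using g by (auto simp: bij_betw_def intro: inj_on_subset)
    moreover have "g ` {x\<in>X. f x = b} \<subseteq> {b * q..<b * q + q}"
    proof
      fix y assume "y \<in> g ` {x\<in>X. f x = b}"
      then have "y div q = b" by (auto simp: f_def)
      then have "y = b * q + y mod q" by (metis div_mult_mod_eq)
      then show "y \<in> {b * q..<b * q + q}"
        using mod_less_divisor[OF assms(3), of y] by (simp del: mod_less_divisor)
    qed
    ultimately have "card {x\<in>X. f x = b} \<le> card {b * q..<b * q + q}"
      by (intro card_inj_on_le) auto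
    then show "card {x\<in>X. f x = b} \<le> q" by simp
  qed
qed

lemma sum_le_card_mult:
  fixes h :: "'a \<Rightarrow> real"
  assumes "\<And>i. i \<in> X \<Longrightarrow> h i \<le> d" "card X \<le> n" "0 \<le> d"
  shows "sum h X \<le> real n * d"
  by (metis (no_types, opaque_lifting) assms mult_right_mono of_nat_le_iff order_trans
      sum_bounded_above)

lemma opt_bins_tiny_le:
  assumes "0 < k" "length L \<le> k * r" "\<forall>i<length L. L ! i \<le> 1 / real k"
  shows "opt_bins k L \<le> r"
proof -
  obtain f where f: "f ` {..<length L} \<subseteq> {..<r}" "\<And>b. card {i\<in>{..<length L}. f i = b} \<le> k"
    using bounded_fibres[of "{..<length L}" k r] assms by auto
  have card: "card (bin_items L f b) \<le> k" for b using f(2)[of b] by (simp add: bin_items_def)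
  have "(\<Sum>i\<in>bin_items L f b. L ! i) \<le> real k * (1 / real k)" for b
    using assms(3) card by (intro sum_le_card_mult) (auto simp: bin_items_def)
  then have "feasible_packing k L f"
    using card assms(1) by (simp add: feasible_packing_def)
  then have "opt_bins k L \<le> bins_used L f" by (rule opt_bins_le)
  also have "\<dots> \<le> r" unfolding bins_used_def using card_mono[OF _ f(1)] by simp
  finally show ?thesis .
qed

text \<open>A huge item leaves room for exactly \<open>k - 1\<close> items of size
  \<open>lo\<close>. So \<open>n\<close> bins take the huge items and those violating
  \<open>P\<close>, and \<open>r\<close> further bins take those satisfying \<open>P\<close>, at
  most \<open>k\<close> in each.\<close>

lemma opt_bins_huge_le:
  assumes k: "2 \<le> k" and lo: "0 \<le> lo" "lo \<le> 1 / real k"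
    and tiny: "\<forall>i<length L. L ! i \<le> 1 / real k"
    and big: "card {i. i < length L \<and> P i} \<le> k * r"
    and small: "card {i. i < length L \<and> \<not> P i} \<le> (k - 1) * n"
      "\<And>i. \<lbrakk>i < length L; \<not> P i\<rbrakk> \<Longrightarrow> L ! i \<le> lo"
  shows "opt_bins k (L @ replicate n (1 - real (k - 1) * lo)) \<le> n + r"
proof -
  let ?N = "length L" and ?B = "{i. i < length L \<and> P i}" and ?S = "{i. i < length L \<and> \<not> P i}"
  let ?L = "L @ replicate n (1 - real (k - 1) * lo)"
  obtain f where f: "f ` ?S \<subseteq> {..<n}" "\<And>b. card {i\<in>?S. f i = b} \<le> k - 1"
    using bounded_fibres[OF _ small(1)] k by auto
  obtain g where g: "g ` ?B \<subseteq> {..<r}" "\<And>b. card {i\<in>?B. g i = b} \<le> k"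
    using bounded_fibres[OF _ big] k by auto
  have f': "i < ?N \<Longrightarrow> \<not> P i \<Longrightarrow> f i < n" for i using f(1) by blast
  define p where "p i = (if ?N \<le> i then i - ?N else if P i then n + g i else f i)" for i
  have lt: "bin_items ?L p b = insert (?N + b) {i\<in>?S. f i = b}" if "b < n" for b
  proof (rule set_eqI)
    fix i
    show "i \<in> bin_items ?L p b \<longleftrightarrow> i \<in> insert (?N + b) {i\<in>?S. f i = b}"
      using that f'[of i] by (auto simp: bin_items_def p_def)
  qed
  have ge: "bin_items ?L p b = {i\<in>?B. g i = b - n}" if "\<not> b < n" for b
  proof (rule set_eqI)
    fix i
    show "i \<in> bin_items ?L p b \<longleftrightarrow> i \<in> {i\<in>?B. g i = b - n}"
      using that f'[of i] by (auto simp: bin_items_def p_def)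
  qed
  have "(\<Sum>i\<in>bin_items ?L p b. ?L ! i) \<le> 1 \<and> card (bin_items ?L p b) \<le> k" for b
  proof (cases "b < n")
    case True
    have "(\<Sum>i\<in>{i\<in>?S. f i = b}. ?L ! i) \<le> real (k - 1) * lo"
      using small(2) f(2)[of b] lo by (intro sum_le_card_mult) (auto simp: nth_append)
    moreover have "card (insert (?N + b) {i\<in>?S. f i = b}) \<le> k"
      using f(2)[of b] k by (subst card_insert_disjoint) auto
    ultimately show ?thesis unfolding lt[OF True] using True by (simp add: nth_append)
  next
    case False
    have "(\<Sum>i\<in>{i\<in>?B. g i = b - n}. ?L ! i) \<le> real k * (1 / real k)"
      using tiny g(2)[of "b - n"] by (intro sum_le_card_mult) (auto simp: nth_append)
    then show ?thesis unfolding ge[OF False] using g(2)[of "b - n"] k by simp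
  qed
  then have "feasible_packing k ?L p" by (simp add: feasible_packing_def)
  then have "opt_bins k ?L \<le> bins_used ?L p" by (rule opt_bins_le)
  also have "\<dots> \<le> card {..<n + r}"
    unfolding bins_used_def using f(1) g(1)
    by (intro card_mono) (auto simp: p_def image_subset_iff trans_less_add1)
  finally show ?thesis by simp
qed

section \<open>Forcing the algorithm to open new bins\<close>

lemma bin_pair_le:
  assumes "feasible_packing k L p" "valid_input L" "i < length L" "j < length L" "i \<noteq> j" "p i = p j"
  shows "L ! i + L ! j \<le> 1"
proof -
  have "(\<Sum>l\<in>{i, j}. L ! l) \<le> (\<Sum>l\<in>bin_items L p (p j). L ! l)"
    using assms by (intro sum_mono2) (auto simp: bin_items_def valid_input_def intro: less_imp_le)
  also have "\<dots> \<le> 1" using assms(1) by (simp add: feasible_packing_def)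
  finally show ?thesis using assms(5) by simp
qed

text \<open>Every bin used for \<open>L\<close> contains its opening item, which is too large to
  share a bin with a huge item, and two huge items never fit together.\<close>

lemma alg_bins_huge:
  assumes A: "ccbp_algorithm k A" and L: "valid_input L" and h: "1/2 < h" "h \<le> 1"
    and big: "\<And>i. \<lbrakk>i < length L; opens_bin A L i\<rbrakk> \<Longrightarrow> 1 - h < L ! i"
  shows "alg_bins A L + n \<le> alg_bins A (L @ replicate n h)"
proof -
  let ?N = "length L" and ?L = "L @ replicate n h"
  let ?p = "alg_packing A ?L"
  have v: "valid_input ?L" using L h by (auto simp: valid_input_def)
  then have feas: "feasible_packing k ?L ?p" using A by (simp add: ccbp_algorithm_def)
  have sep: "?p i \<noteq> ?p j" if ij: "i < j" "?N \<le> j" "j < ?N + n" for i j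
  proof
    assume eq: "?p i = ?p j"
    show False
    proof (cases "i < ?N")
      case True
      then obtain l where l: "l \<le> i" "opens_bin A L l" "alg_packing A L l = alg_packing A L i"
        using opens_bin_exists by blast
      then have "?p l = ?p j" using eq True by (simp add: alg_packing_append)
      then have "?L ! l + ?L ! j \<le> 1"
        using bin_pair_le[OF feas v, of l j] l ij True by simp
      then show False using big[OF _ l(2)] l(1) True ij by (simp add: nth_append)
    next
      case False
      then have "?L ! i + ?L ! j \<le> 1" using bin_pair_le[OF feas v, of i j] ij eq by simp
      then show False using False ij h by (simp add: nth_append)
    qed
  qed
  have "inj_on ?p {?N..<?N + n}"
    by (rule inj_onI) (metis atLeastLessThan_iff linorder_neqE_nat sep)
  moreover have "?p ` {..<?N} \<inter> ?p ` {?N..<?N + n} = {}"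
    using sep by fastforce
  moreover have "{..<length ?L} = {..<?N} \<union> {?N..<?N + n}" by auto
  ultimately have "alg_bins A ?L = card (?p ` {..<?N}) + n"
    by (simp add: alg_bins_def bins_used_def image_Un card_Un_disjoint card_image)
  moreover have "?p ` {..<?N} = alg_packing A L ` {..<?N}"
    by (intro image_cong) (auto simp: alg_packing_append)
  ultimately show ?thesis by (simp add: alg_bins_def bins_used_def)
qed

lemma hard_input_exists:
  assumes A: "ccbp_algorithm k A" and k: "3 \<le> k"
  obtains L where "valid_input L" "K \<le> opt_bins k L"
    "2 * real k / (real k + 2) \<le> real (alg_bins A L) / real (opt_bins k L)"
proof -
  define j where "j = Suc K"
  \<comment> \<open>A multiple of \<open>k\<close>, so that \<open>2 * n\<close> large items fill
    exactly \<open>2 * j\<close> bins.\<close>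
  define n where "n = k * j"
  have Kn: "K \<le> n" and n0: "0 < n" using k mult_le_mono1[of 1 k j] by (auto simp: n_def j_def)
  \<comment> \<open>The gap ratio \<open>k\<close> gives \<open>(k - 1) * lo < hi\<close>, so a huge
    item of size \<open>1 - (k - 1) * lo\<close> fits with no item that opened a bin.\<close>
  obtain L lo hi where len: "length L = k * n" and lo: "0 < lo" "real k * lo \<le> hi" "hi \<le> 1 / real k"
    and L: "\<forall>i<k * n. 0 < L ! i \<and> L ! i \<le> 1 / real k \<and>
              (if opens_bin A L i then hi \<le> L ! i else L ! i \<le> lo)"
    using adaptive_gap[of "real k" k "k * n" A] k by auto
  have inv_k: "1 / real k \<le> 1 / 3" using k by (simp add: divide_simps)
  have v: "valid_input L"
    using L len inv_k by (fastforce simp: valid_input_def in_set_conv_nth)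
  note found = that
  \<comment> \<open>Common end of both branches: stopping after the tiny items, or continuing with
    the huge ones.\<close>
  have ratio: thesis
    if L': "valid_input L'" "length L' \<ge> k * n" "2 * n \<le> alg_bins A L'" "opt_bins k L' \<le> n + 2 * j" for L'
  proof (rule found[OF L'(1)])
    have "k * n \<le> k * opt_bins k L'"
      using opt_bins_ge_length[OF L'(1), of k] L'(2) k by linarith
    then have opt: "n \<le> opt_bins k L'" using k by simp
    then show "K \<le> opt_bins k L'" using Kn by simp
    have "2 * real k / (real k + 2) = real (2 * n) / real (n + 2 * j)"
    proof -
      have "real (2 * n) = 2 * real k * real j" "real (n + 2 * j) = (real k + 2) * real j"
        by (auto simp: n_def algebra_simps)
      then show ?thesis by (simp add: j_def del: of_nat_Suc)
    qed
    also have "\<dots> \<le> real (alg_bins A L') / real (opt_bins k L')"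
      using L'(3,4) opt n0 by (intro frac_le) auto
    finally show "2 * real k / (real k + 2) \<le> real (alg_bins A L') / real (opt_bins k L')" .
  qed
  let ?m = "alg_bins A L"
  show thesis
  proof (cases "2 * n \<le> ?m")
    case True
    have "opt_bins k L \<le> n" using L len k by (intro opt_bins_tiny_le) auto
    then show thesis using True v len by (intro ratio[of L]) auto
  next
    case False
    let ?h = "1 - real (k - 1) * lo"
    \<comment> \<open>The \<open>k * n\<close> tiny items force \<open>n\<close> bins, which leaves
      at most \<open>(k - 1) * n\<close> items that open none.\<close>
    have m: "n \<le> ?m"
    proof -
      have "opt_bins k L \<le> ?m"
        using A v unfolding alg_bins_def by (intro opt_bins_le) (simp add: ccbp_algorithm_def)
      moreover have "k * n \<le> k * opt_bins k L" using opt_bins_ge_length[OF v, of k] len k by simp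
      then have "n \<le> opt_bins k L" using k by simp
      ultimately show ?thesis by simp
    qed
    have d: "real (k - 1) * lo < hi" "0 \<le> real (k - 1) * lo"
      using lo k by (auto simp: of_nat_diff algebra_simps)
    have h: "1/2 < ?h" "?h \<le> 1" using d lo inv_k by auto
    have big: "card {i. i < length L \<and> opens_bin A L i} = ?m" by (rule card_opens_bin)
    have "{i. i < length L \<and> \<not> opens_bin A L i} = {..<length L} - {i. i < length L \<and> opens_bin A L i}"
      by auto
    then have "card {i. i < length L \<and> \<not> opens_bin A L i} = k * n - ?m"
      using big len by (simp add: card_Diff_subset subset_iff)
    then have small: "card {i. i < length L \<and> \<not> opens_bin A L i} \<le> (k - 1) * n"
      using m by (simp add: diff_mult_distrib)
    have "lo \<le> 1 / real k"
    proof -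
      have "1 * lo \<le> real k * lo" using lo k by (intro mult_right_mono) auto
      then show ?thesis using lo(2,3) by linarith
    qed
    \<comment> \<open>Fewer than \<open>2 * n = k * (2 * j)\<close> items opened a bin, so
      \<open>2 * j\<close> bins suffice for them.\<close>
    then have "opt_bins k (L @ replicate n ?h) \<le> n + 2 * j"
      using L len lo k small big False
      by (intro opt_bins_huge_le[where P = "opens_bin A L"]) (auto simp: n_def split: if_splits)
    moreover have "?m + n \<le> alg_bins A (L @ replicate n ?h)"
      using L len d by (intro alg_bins_huge[OF A v h]) (force split: if_splits)
    ultimately show thesis
      using v h m len by (intro ratio[of "L @ replicate n ?h"]) (auto simp: valid_input_def)
  qed
qed

section \<open>Passage to the limit\<close>

lemma R_asym_ge:
  assumes "3 \<le> k"
  shows "ereal (2 * real k / (real k + 2)) \<le> R_asym k"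
  unfolding R_asym_def
proof (rule INF_greatest)
  fix A assume "A \<in> {A. ccbp_algorithm k A}"
  then have A: "ccbp_algorithm k A" by simp
  show "ereal (2 * real k / (real k + 2)) \<le> asym_ratio k A"
  proof (rule LIMSEQ_le_const[OF asym_ratio_LIMSEQ], intro exI[of _ 0] allI impI)
    fix K :: nat
    obtain L where L: "valid_input L" "K \<le> opt_bins k L"
      "2 * real k / (real k + 2) \<le> real (alg_bins A L) / real (opt_bins k L)"
      using hard_input_exists[OF A assms] .
    then show "ereal (2 * real k / (real k + 2)) \<le>
        (SUP L\<in>{L. valid_input L \<and> K \<le> opt_bins k L}. perf_ratio k A L)"
      by (intro SUP_upper2[of L]) (auto simp: perf_ratio_def)
  qed
qed

lemma SUP_R_asym_ge: "2 \<le> (SUP k\<in>{2..}. R_asym k)"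
proof (rule LIMSEQ_le_const2)
  \<comment> \<open>The lower bound \<open>2 * k / (k + 2)\<close> is rewritten as
    \<open>2 - 4 / (k + 2)\<close>.\<close>
  have "(\<lambda>k. 2 - 4 * inverse (real (Suc (Suc k)))) \<longlonglongrightarrow> 2 - 4 * 0"
    by (intro tendsto_intros LIMSEQ_Suc[OF LIMSEQ_inverse_real_of_nat])
  moreover have "2 - 4 * inverse (real (Suc (Suc k))) = 2 * real k / (real k + 2)" for k
    by (simp add: field_simps)
  ultimately have "(\<lambda>k. 2 * real k / (real k + 2)) \<longlonglongrightarrow> 2" by simp
  then have "(\<lambda>k. ereal (2 * real k / (real k + 2))) \<longlonglongrightarrow> ereal 2" by simp
  then show "(\<lambda>k. ereal (2 * real k / (real k + 2))) \<longlonglongrightarrow> 2" by simp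
  have "ereal (2 * real k / (real k + 2)) \<le> (SUP k\<in>{2..}. R_asym k)" if "3 \<le> k" for k
  proof -
    have "R_asym k \<le> (SUP k\<in>{2..}. R_asym k)" using that by (intro SUP_upper) simp
    then show ?thesis using R_asym_ge[OF that] by (rule order_trans[rotated])
  qed
  then show "\<exists>N. \<forall>k\<ge>N. ereal (2 * real k / (real k + 2)) \<le> (SUP k\<in>{2..}. R_asym k)"
    by blast
qed

theorem theorem5:
  shows "(SUP k\<in>{2..}. R_asym k) = 2 \<and> (SUP k\<in>{2..}. R_abs k) = 2"
proof -
  have "(SUP k\<in>{2..}. R_asym k) \<le> (SUP k\<in>{2..}. R_abs k)"
    by (intro SUP_mono) (auto intro: R_asym_le_R_abs)
  moreover have "(SUP k\<in>{2..}. R_abs k) \<le> 2"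
    by (intro SUP_least R_abs_le_2) simp
  ultimately show ?thesis using SUP_R_asym_ge by (metis antisym order_trans)
qed

end
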